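(* Let $\mathcal{Q}$ be an optimum achieving (OA) quantization scheme for the quantized primal-dual algorithm. Then $$\liminf_{k\to\infty}\frac1k\log \mathsf{E}\left[\|\boldsymbol{\epsilon}^{\boldsymbol{\lambda}}_k\|_2^2\right]\ \ge\ -\frac{2}{N}R_{\boldsymbol{x}},$$ where $\boldsymbol{\epsilon}^{\boldsymbol{\lambda}}_k=\boldsymbol{\lambda}_k-\boldsymbol{\lambda}^\star$.
   Context: **Problem.** Let $N<M$ be positive integers, $A\in\mathbb{R}^{N\times M}$, $\boldsymbol{b}\in\mathbb{R}^N$, $U_i:\mathbb{R}\to\mathbb{R}$ ($1\le i\le M$). Consider: maximize $\sum_{i=1}^M U_i(x^i)$ over $\boldsymbol{x}=[x^1,\dots,x^M]^\top$ subject to $A\boldsymbol{x}=\boldsymbol{b}$. Let $\boldsymbol{x}^\star,\boldsymbol{\lambda}^\star$ be the optimal primal and dual solutions. $A_i$ is the $i$th column of $A$, $\bar A_j$ its $j$th row. **Quantization scheme.** At time $k\ge 0$, agent $i$ encodes $x^i_k$ into a symbol $\hat Q^{\boldsymbol{x}}_{i,k}=E^{\boldsymbol{x}}_{i,k}(\{x^i_n\}_{n=0}^k,\{\hat Q^{\boldsymbol{x}}_{i,n}\}_{n=0}^{k-1})$ in a finite alphabet $\mathcal{A}^{\boldsymbol{x}}_{i,k}$, and the quantized value is reconstructed as $Q^{\boldsymbol{x}}_{i,k}=D^{\boldsymbol{x}}_{i,k}(\{\hat Q^{\boldsymbol{x}}_{i,n}\}_{n=0}^k)$. Likewise, network node $j$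 ($1\le j\le N$) encodes $\lambda^j_k$ into $\hat Q^{\boldsymbol{\lambda}}_{j,k}=E^{\boldsymbol{\lambda}}_{j,k}(\{\lambda^j_n\}_{n=0}^k,\{\hat Q^{\boldsymbol{\lambda}}_{j,n}\}_{n=0}^{k-1})$ in a finite alphabet $\mathcal{A}^{\boldsymbol{\lambda}}_{j,k}$, with reconstruction $Q^{\boldsymbol{\lambda}}_{j,k}=D^{\boldsymbol{\lambda}}_{j,k}(\{\hat Q^{\boldsymbol{\lambda}}_{j,n}\}_{n=0}^k)$. The collection $\mathcal{Q}$ of all these encoder and decoder maps is a quantization scheme. Write $Q^{\boldsymbol{x}}_k=[Q^{\boldsymbol{x}}_{1,k},\dots,Q^{\boldsymbol{x}}_{M,k}]^\top$, $Q^{\boldsymbol{\lambda}}_k=[Q^{\boldsymbol{\lambda}}_{1,k},\dots,Q^{\boldsymbol{\lambda}}_{N,k}]^\top$. **Quantized primal-dual (PD) algorithm.** For $k\ge1$, $$x^i_k=x^i_{k-1}+\mu_{k-1}\left(U_i'(x^i_{k-1})-A_i^\top Q^{\boldsymbol{\lambda}}_{k-1}\right),\qquad \lambda^j_k=\lambda^j_{k-1}+\mu_{k-1}\left(\bar A_jQ^{\boldsymbol{x}}_{k-1}-b_j\right).$$ The initial vectors $\boldsymbol{x}_0,\boldsymbol{\lambda}_0$ are random with densities $p_{\boldsymbol{x}_0},p_{\boldsymbol{\lambda}_0}$. **Standing assumptions.** (1) Each $U_i$ is concave and twice continuously differentiable. (2) There are constants with $U_i^{\min}\le U_i''(x)\le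 U_i^{\max}<0$ for all $x\in\mathbb{R}$ and all $i$. (3) $\mu_k\le\min_i 1/|U_i^{\min}|$ for all $k$. (4) $\mu_k\to\mu^\star>0$. (5) $\boldsymbol{x}_0$ and $\boldsymbol{\lambda}_0$ are independent and have finite differential entropies ($\mathsf{h}[\boldsymbol{z}]=-\int p_{\boldsymbol{z}}\log p_{\boldsymbol{z}}$). **OA scheme.** $\mathcal{Q}$ is optimum achieving (OA) if under $\mathcal{Q}$, $\lim_k\boldsymbol{x}_k=\boldsymbol{x}^\star$ and $\lim_k\boldsymbol{\lambda}_k=\boldsymbol{\lambda}^\star$, for any initial vectors in the supports of their densities. **Data rate.** $R_{\boldsymbol{x}}=\lim_{k\to\infty}\frac1k\sum_{t=0}^{k-1}\sum_{i=1}^M\log|\mathcal{A}^{\boldsymbol{x}}_{i,t}|$ (limit assumed to exist). Logarithms are natural. *)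

theory Defs
  imports "HOL-Probability.Probability"
begin

text \<open>
  Index \<open>i\<close>, time \<open>k\<close>: at time \<open>k\<close> the encoder sees the list of the signal values at times
  \<open>0, \<dots>, k\<close> (length \<open>k + 1\<close>) and the list of the symbols emitted at times \<open>0, \<dots>, k - 1\<close>
  (length \<open>k\<close>); the decoder sees the list of the symbols emitted at times \<open>0, \<dots>, k\<close>.
  A quantization scheme consists of one such quantizer for the primal variables
  (\<open>i\<close> ranging over the agents) and one for the dual variables (\<open>i\<close> ranging over the nodes).
\<close>

record ('i, 's) quantizer =
  alphabet :: "'i \<Rightarrow> nat \<Rightarrow> 's set"
  encoder :: "'i \<Rightarrow> nat \<Rightarrow> real list \<Rightarrow> 's list \<Rightarrow> 's"
  decoder :: "'i \<Rightarrow> nat \<Rightarrow> 's list \<Rightarrow> real"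

definition valid_quantizer :: "('i, 's) quantizer \<Rightarrow> bool" where
  "valid_quantizer Q \<longleftrightarrow>
     (\<forall>i k. finite (alphabet Q i k)) \<and>
     (\<forall>i k zs qs. length zs = Suc k \<and> length qs = k \<and> (\<forall>n<k. qs ! n \<in> alphabet Q i n)
        \<longrightarrow> encoder Q i k zs qs \<in> alphabet Q i k)"

text \<open>The first \<open>k\<close> symbols emitted by the \<open>i\<close>-th encoder for the scalar signal \<open>z\<close>.\<close>

primrec symbols :: "('i, 's) quantizer \<Rightarrow> 'i \<Rightarrow> (nat \<Rightarrow> real) \<Rightarrow> nat \<Rightarrow> 's list" where
  "symbols Q i z 0 = []"
| "symbols Q i z (Suc k) =
     symbols Q i z k @ [encoder Q i k (map z [0..<Suc k]) (symbols Q i z k)]"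

definition quantized :: "('i::finite, 's) quantizer \<Rightarrow> (nat \<Rightarrow> real ^ 'i) \<Rightarrow> nat \<Rightarrow> real ^ 'i" where
  "quantized Q z k = (\<chi> i. decoder Q i k (symbols Q i (\<lambda>n. z n $ i) (Suc k)))"

text \<open>
  The recursion determines the trajectory uniquely from \<open>x 0\<close> and \<open>l 0\<close>.
\<close>

definition quantized_pd ::
  "('m::finite \<Rightarrow> real \<Rightarrow> real) \<Rightarrow> real ^ 'm ^ 'n::finite \<Rightarrow> real ^ 'n \<Rightarrow> (nat \<Rightarrow> real)
   \<Rightarrow> ('m, 's) quantizer \<Rightarrow> ('n, 't) quantizer
   \<Rightarrow> (nat \<Rightarrow> real ^ 'm) \<Rightarrow> (nat \<Rightarrow> real ^ 'n) \<Rightarrow> bool" where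
  "quantized_pd U A b \<mu> Qx Ql x l \<longleftrightarrow>
     (\<forall>k i. x (Suc k) $ i =
        x k $ i + \<mu> k * (deriv (U i) (x k $ i) - column i A \<bullet> quantized Ql l k)) \<and>
     (\<forall>k j. l (Suc k) $ j =
        l k $ j + \<mu> k * (row j A \<bullet> quantized Qx x k - b $ j))"

definition primal_optimal ::
  "('m::finite \<Rightarrow> real \<Rightarrow> real) \<Rightarrow> real ^ 'm ^ 'n::finite \<Rightarrow> real ^ 'n \<Rightarrow> real ^ 'm \<Rightarrow> bool" where
  "primal_optimal U A b = is_arg_max (\<lambda>x. \<Sum>i\<in>UNIV. U i (x $ i)) (\<lambda>x. A *v x = b)"

definition dual_function ::
  "('m::finite \<Rightarrow> real \<Rightarrow> real) \<Rightarrow> real ^ 'm ^ 'n::finite \<Rightarrow> real ^ 'n \<Rightarrow> real ^ 'n \<Rightarrow> ereal" where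
  "dual_function U A b l = (SUP x. ereal ((\<Sum>i\<in>UNIV. U i (x $ i)) - l \<bullet> (A *v x - b)))"

definition dual_optimal ::
  "('m::finite \<Rightarrow> real \<Rightarrow> real) \<Rightarrow> real ^ 'm ^ 'n::finite \<Rightarrow> real ^ 'n \<Rightarrow> real ^ 'n \<Rightarrow> bool" where
  "dual_optimal U A b = is_arg_min (dual_function U A b) (\<lambda>_. True)"

text \<open>
  The support of a density \<open>p\<close> is read as \<open>{z. p z > 0}\<close>, without taking the closure.
\<close>

definition optimum_achieving ::
  "('m::finite \<Rightarrow> real \<Rightarrow> real) \<Rightarrow> real ^ 'm ^ 'n::finite \<Rightarrow> real ^ 'n \<Rightarrow> (nat \<Rightarrow> real)
   \<Rightarrow> (real ^ 'm \<Rightarrow> real) \<Rightarrow> (real ^ 'n \<Rightarrow> real) \<Rightarrow> real ^ 'm \<Rightarrow> real ^ 'n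
   \<Rightarrow> ('m, 's) quantizer \<Rightarrow> ('n, 't) quantizer \<Rightarrow> bool" where
  "optimum_achieving U A b \<mu> px pl xopt lopt Qx Ql \<longleftrightarrow>
     (\<forall>x l. quantized_pd U A b \<mu> Qx Ql x l \<and> px (x 0) > 0 \<and> pl (l 0) > 0
        \<longrightarrow> x \<longlonglongrightarrow> xopt \<and> l \<longlonglongrightarrow> lopt)"

definition average_rate :: "('i::finite, 's) quantizer \<Rightarrow> nat \<Rightarrow> real" where
  "average_rate Q k = (1 / real k) * (\<Sum>t<k. \<Sum>i\<in>UNIV. ln (real (card (alphabet Q i t))))"

text \<open>Natural logarithm on \<open>[0, \<infinity>]\<close>.\<close>

definition ln_ennreal :: "ennreal \<Rightarrow> ereal" where
  "ln_ennreal y = (if y = 0 then -\<infinity> else if y = \<infinity> then \<infinity> else ereal (ln (enn2real y)))"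

end

theory Submission
  imports Defs
begin

text \<open>
  The dual recursion uses the data \<open>x\<close> only through the reconstructed values. Hence \<open>L k - L 0\<close> is a
  function of the symbols that the agents emit before time \<open>k\<close>, and it takes at most
  \<open>S k = (\<Prod>i. \<Prod>t<k. card (alphabet Qx i t)) = exp (k * average_rate Qx k)\<close> values. The error
  \<open>L k - lopt\<close> is therefore the distance vector from \<open>lopt - (L k - L 0)\<close>, which is one of \<open>S k\<close>
  fixed points, to \<open>L 0\<close>, so the mean-square error is at least that of the best quantizer of \<open>L 0\<close> with \<open>S k\<close> points.

  Because \<open>L 0\<close> has a density, such a quantizer cannot be good. At least half of the
  probability mass sits where the density is at most a constant \<open>B\<close>; on this part, \<open>S k\<close> balls of
  radius \<open>r\<close> in dimension \<open>N\<close> capture at most \<open>S k * B * vol * r^N\<close>, where \<open>vol\<close> is the volume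
  of the unit ball. If \<open>r\<close> is a suitable multiple of \<open>S k powr (- 1 / N)\<close>, at least a quarter
  of the mass stays at distance \<open>r\<close> or more, which yields the bound \<open>c * S k powr (- 2 / N)\<close> of
  \<open>quantization_error_lower_bound\<close>. Taking logarithms and dividing by \<open>k\<close> makes the
  constant \<open>c\<close> vanish in the limit and leaves \<open>- (2 / N) * average_rate Qx k\<close>.
\<close>

section \<open>Mean-square error of finite quantization\<close>

lemma density_bounded_on_half:
  fixes Z :: "'w \<Rightarrow> 'a::euclidean_space" and p :: "'a \<Rightarrow> real"
  assumes "prob_space P" and Z: "Z \<in> measurable P borel" and p: "p \<in> borel_measurable borel"
  shows "\<exists>B>0. measure P {\<omega> \<in> space P. p (Z \<omega>) \<le> B} \<ge> 1 / 2"
proof -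
  interpret prob_space P by fact
  let ?E = "\<lambda>n::nat. {\<omega> \<in> space P. p (Z \<omega>) \<le> real n}"
  have meas: "?E n \<in> sets P" for n using Z p by measurable
  have "(\<lambda>n. measure P (?E n)) \<longlonglongrightarrow> measure P (\<Union>n. ?E n)"
    by (rule finite_Lim_measure_incseq) (use meas in \<open>auto simp: incseq_def\<close>)
  moreover have "(\<Union>n. ?E n) = space P"
    using real_arch_simple by auto
  ultimately have "(\<lambda>n. measure P (?E n)) \<longlonglongrightarrow> 1" by (simp add: prob_space)
  then have "\<forall>\<^sub>F n in sequentially. measure P (?E n) > 1 / 2"
    by (rule order_tendstoD) simp
  moreover have "\<forall>\<^sub>F n::nat in sequentially. n > 0" by (rule eventually_gt_at_top)
  ultimately have "\<forall>\<^sub>F n in sequentially. measure P (?E n) > 1 / 2 \<and> n > 0"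
    by eventually_elim simp
  then obtain n where "measure P (?E n) > 1 / 2" "n > 0"
    using eventually_happens'[OF sequentially_bot] by blast
  then show ?thesis by (intro exI[of _ "real n"]) auto
qed

lemma prob_near_point_le:
  fixes Z :: "'w \<Rightarrow> 'a::euclidean_space" and p :: "'a \<Rightarrow> real"
  assumes "prob_space P" and Z: "distributed P lborel Z (\<lambda>z. ennreal (p z))"
    and p: "p \<in> borel_measurable borel" and B: "B > 0" and r: "r > 0"
  shows "measure P {\<omega> \<in> space P. p (Z \<omega>) \<le> B \<and> norm (Z \<omega> + d) < r}
    \<le> B * (unit_ball_vol (real DIM('a)) * r ^ DIM('a))"
proof -
  interpret prob_space P by fact
  let ?S = "{z. p z \<le> B} \<inter> ball (- d) r"
  have ball_iff: "dist (- d) z = norm (z + d)" for z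
    by (metis dist_norm dist_commute diff_minus_eq_add)
  have S: "?S \<in> sets lborel" using p by measurable
  have "emeasure P {\<omega> \<in> space P. p (Z \<omega>) \<le> B \<and> norm (Z \<omega> + d) < r} = emeasure P (Z -` ?S \<inter> space P)"
    by (intro arg_cong[where f = "emeasure P"]) (auto simp: ball_iff)
  also have "\<dots> = (\<integral>\<^sup>+z. ennreal (p z) * indicator ?S z \<partial>lborel)"
    by (rule distributed_emeasure[OF Z S])
  also have "\<dots> \<le> (\<integral>\<^sup>+z. ennreal B * indicator (ball (- d) r) z \<partial>lborel)"
    by (intro nn_integral_mono) (auto simp: indicator_def intro!: ennreal_leI)
  also have "\<dots> = ennreal B * emeasure lborel (ball (- d) r)"
    by (simp add: nn_integral_cmult_indicator)
  also have "\<dots> = ennreal (B * (unit_ball_vol (real DIM('a)) * r ^ DIM('a)))"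
    using B r by (simp add: emeasure_ball ennreal_mult)
  finally show ?thesis
    using B r by (simp add: emeasure_eq_measure)
qed

text \<open>
  Where the density is at most \<open>B\<close>, few small balls carry little mass, so \<open>Z\<close> is often far from
  every point of \<open>uminus ` C\<close>, and then \<open>F\<close> is large. Encoders and decoders are arbitrary
  functions, so the error \<open>F\<close> of a quantizer can fail to be measurable; the proof bounds it below
  pointwise by a multiple of the indicator of a measurable event, which suffices because the
  nonnegative integral is a lower integral.
\<close>

theorem quantization_error_lower_bound:
  fixes Z :: "'w \<Rightarrow> 'a::euclidean_space" and p :: "'a \<Rightarrow> real"
  assumes "prob_space P" and Z: "distributed P lborel Z (\<lambda>z. ennreal (p z))"
    and p: "p \<in> borel_measurable borel"
  shows "\<exists>c>0. \<forall>C F s. finite C \<longrightarrow> real (card C) \<le> s \<longrightarrow> s > 0 \<longrightarrow> (\<forall>\<omega>\<in>space P. F \<omega> - Z \<omega> \<in> C)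
    \<longrightarrow> ennreal (c * s powr (- 2 / real DIM('a))) \<le> (\<integral>\<^sup>+ \<omega>. ennreal ((norm (F \<omega>))\<^sup>2) \<partial>P)"
proof -
  interpret prob_space P by fact
  have Zm: "Z \<in> measurable P borel" using distributed_measurable[OF Z] by simp
  obtain B where B: "B > 0" and half: "measure P {\<omega> \<in> space P. p (Z \<omega>) \<le> B} \<ge> 1 / 2"
    using density_bounded_on_half[OF \<open>prob_space P\<close> Zm p] by blast
  define N where "N = DIM('a)"
  define v where "v = unit_ball_vol (real N)"
  have v: "v > 0" by (simp add: v_def)
  have N: "N > 0" by (simp add: N_def)
  define c where "c = (4 * B * v) powr (- 2 / real N) / 4"
  have c: "c > 0" using B v by (simp add: c_def)
  have "ennreal (c * s powr (- 2 / real N)) \<le> (\<integral>\<^sup>+ \<omega>. ennreal ((norm (F \<omega>))\<^sup>2) \<partial>P)"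
    if C: "finite C" "real (card C) \<le> s" and s: "s > 0" and F: "\<And>\<omega>. \<omega> \<in> space P \<Longrightarrow> F \<omega> - Z \<omega> \<in> C"
    for C s and F :: "'w \<Rightarrow> 'a"
  proof -
    \<comment> \<open>The radius for which \<open>s\<close> balls capture at most a quarter of the mass.\<close>
    define r where "r = (4 * B * v * s) powr (- 1 / real N)"
    have r: "r > 0" using B v s by (simp add: r_def)
    have rN: "r ^ N = 1 / (4 * B * v * s)"
    proof -
      have "r ^ N = r powr real N" using r by (simp add: powr_realpow)
      also have "\<dots> = (4 * B * v * s) powr - 1" unfolding r_def powr_powr using N by simp
      finally show ?thesis using B v s by (simp add: powr_minus_divide)
    qed
    have r2: "r\<^sup>2 / 4 = c * s powr (- 2 / real N)"
      using B v s by (simp add: r_def c_def powr_powr powr_mult flip: powr_numeral)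
    let ?G = "{\<omega> \<in> space P. p (Z \<omega>) \<le> B}"
    let ?near = "\<lambda>d. {\<omega> \<in> space P. p (Z \<omega>) \<le> B \<and> norm (Z \<omega> + d) < r}"
    let ?far = "?G - (\<Union>d\<in>C. ?near d)"
    have G: "?G \<in> sets P" using Zm p by measurable
    have near: "?near d \<in> sets P" for d using Zm p by measurable
    have U: "(\<Union>d\<in>C. ?near d) \<in> sets P" using near C by (intro sets.finite_UN) auto
    have "measure P (\<Union>d\<in>C. ?near d) \<le> (\<Sum>d\<in>C. measure P (?near d))"
      using near C by (intro finite_measure_subadditive_finite) auto
    also have "\<dots> \<le> (\<Sum>d\<in>C. B * (v * r ^ N))"
      unfolding v_def N_def by (intro sum_mono prob_near_point_le[OF \<open>prob_space P\<close> Z p B r])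
    also have "\<dots> = real (card C) * (B * (v * r ^ N))" by simp
    also have "\<dots> \<le> s * (B * (v * r ^ N))" using C B v r by (intro mult_right_mono) auto
    also have "\<dots> = 1 / 4" using B v s by (simp add: rN field_simps)
    finally have "measure P (\<Union>d\<in>C. ?near d) \<le> 1 / 4" .
    moreover have "measure P ?far = measure P ?G - measure P (\<Union>d\<in>C. ?near d)"
      using G U by (intro finite_measure_Diff) auto
    ultimately have far: "measure P ?far \<ge> 1 / 4" using half by simp
    have "ennreal (c * s powr (- 2 / real N)) = ennreal (r\<^sup>2) * ennreal (1 / 4)"
      unfolding r2[symmetric] by (simp flip: ennreal_mult)
    also have "\<dots> \<le> ennreal (r\<^sup>2) * emeasure P ?far"
      using far by (intro mult_left_mono) (auto simp: emeasure_eq_measure intro!: ennreal_leI)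
    also have "\<dots> = (\<integral>\<^sup>+\<omega>. ennreal (r\<^sup>2) * indicator ?far \<omega> \<partial>P)"
      using G U by (simp add: nn_integral_cmult_indicator)
    also have "\<dots> \<le> (\<integral>\<^sup>+ \<omega>. ennreal ((norm (F \<omega>))\<^sup>2) \<partial>P)"
    proof (intro nn_integral_mono)
      fix \<omega> assume \<omega>: "\<omega> \<in> space P"
      show "ennreal (r\<^sup>2) * indicator ?far \<omega> \<le> ennreal ((norm (F \<omega>))\<^sup>2)"
      proof (cases "\<omega> \<in> ?far")
        case True
        then have "\<not> norm (Z \<omega> + (F \<omega> - Z \<omega>)) < r" using F[OF \<omega>] by blast
        then have "r \<le> norm (F \<omega>)" by simp
        then have "r\<^sup>2 \<le> (norm (F \<omega>))\<^sup>2" using r by (intro power_mono) auto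
        then show ?thesis by (simp add: indicator_def ennreal_leI)
      qed simp
    qed
    finally show ?thesis .
  qed
  then show ?thesis unfolding N_def using c by blast
qed

section \<open>Counting dual trajectories\<close>

definition symbol_words :: "('i, 's) quantizer \<Rightarrow> nat \<Rightarrow> 'i \<Rightarrow> 's list set" where
  "symbol_words Q k i = {qs. length qs = k \<and> (\<forall>n<k. qs ! n \<in> alphabet Q i n)}"

lemma symbols_in_symbol_words:
  assumes "valid_quantizer Q"
  shows "symbols Q i z k \<in> symbol_words Q k i"
proof (induction k)
  case (Suc k)
  moreover have "length (map z [0..<Suc k]) = Suc k" by simp
  ultimately have "encoder Q i k (map z [0..<Suc k]) (symbols Q i z k) \<in> alphabet Q i k"
    using assms unfolding valid_quantizer_def symbol_words_def by blast
  then show ?case using Suc by (auto simp: symbol_words_def nth_append less_Suc_eq)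
qed (simp add: symbol_words_def)

lemma take_symbols: "n \<le> k \<Longrightarrow> take n (symbols Q i z k) = symbols Q i z n"
proof (induction k)
  case (Suc k)
  have len: "length (symbols Q i z n) = n" for n by (induction n) auto
  show ?case
  proof (cases "n = Suc k")
    case True
    then show ?thesis using len[of "Suc k"] by (metis take_all order_refl)
  next
    case False
    then show ?thesis using Suc len[of k] by simp
  qed
qed simp

lemma card_symbol_words:
  assumes "valid_quantizer Q"
  shows "finite (symbol_words Q k i)"
    and "card (symbol_words Q k i) = (\<Prod>t<k. card (alphabet Q i t))"
proof -
  have fin: "finite (alphabet Q i t)" for t using assms by (simp add: valid_quantizer_def)
  have "finite (symbol_words Q k i) \<and> card (symbol_words Q k i) = (\<Prod>t<k. card (alphabet Q i t))"
  proof (induction k)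
    case 0
    have "symbol_words Q 0 i = {[]}" by (auto simp: symbol_words_def)
    then show ?case by simp
  next
    case (Suc k)
    let ?f = "\<lambda>(qs, q). qs @ [q]" and ?D = "symbol_words Q k i \<times> alphabet Q i k"
    have "symbol_words Q (Suc k) i = ?f ` ?D"
    proof (intro set_eqI iffI)
      fix w assume w: "w \<in> symbol_words Q (Suc k) i"
      then have "w \<noteq> []" by (auto simp: symbol_words_def)
      then have "w = ?f (butlast w, last w)" by simp
      moreover have "(butlast w, last w) \<in> ?D"
        using w \<open>w \<noteq> []\<close> by (auto simp: symbol_words_def nth_butlast last_conv_nth)
      ultimately show "w \<in> ?f ` ?D" by blast
    qed (auto simp: symbol_words_def nth_append less_Suc_eq)
    moreover have "inj_on ?f ?D" by (auto simp: inj_on_def)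
    ultimately show ?case using Suc fin by (simp add: card_image card_cartesian_product mult.commute)
  qed
  then show "finite (symbol_words Q k i)"
    and "card (symbol_words Q k i) = (\<Prod>t<k. card (alphabet Q i t))" by auto
qed

lemma alphabet_nonempty:
  assumes "valid_quantizer Q"
  shows "alphabet Q i k \<noteq> {}"
  using symbols_in_symbol_words[OF assms, of i "\<lambda>_. 0" "Suc k"] by (auto simp: symbol_words_def)

text \<open>
  This turns the average rate into a count. It relies on alphabets being nonempty, since
  \<open>ln 0 = 0\<close> would make an empty alphabet invisible in the rate.
\<close>

lemma card_joint_symbol_words:
  fixes Q :: "('i::finite, 's) quantizer"
  assumes "valid_quantizer Q" and k: "k > 0"
  shows "real (card (Pi\<^sub>E UNIV (symbol_words Q k))) = exp (real k * average_rate Q k)"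
proof -
  have pos: "card (alphabet Q i t) > 0" for i t
    using alphabet_nonempty[OF assms(1)] assms(1) by (simp add: card_gt_0_iff valid_quantizer_def)
  have "real (card (Pi\<^sub>E UNIV (symbol_words Q k))) = (\<Prod>i\<in>UNIV. \<Prod>t<k. real (card (alphabet Q i t)))"
    by (simp add: card_PiE card_symbol_words[OF assms(1)])
  also have "\<dots> = (\<Prod>t<k. \<Prod>i\<in>UNIV. exp (ln (real (card (alphabet Q i t)))))"
    using pos by (subst prod.swap) simp
  also have "\<dots> = exp (real k * average_rate Q k)"
    using k by (simp add: average_rate_def exp_sum)
  finally show ?thesis .
qed

text \<open>
  Replaying the dual recursion from the words emitted by the agents recovers the dual
  increment. The feedback from the dual to the primal variables influences which words are
  emitted, but not what they contribute, so the set of possible increments is the same for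
  all trajectories.
\<close>

lemma dual_increment_range:
  fixes A :: "real ^ 'm::finite ^ 'n::finite"
  assumes "valid_quantizer Qx"
  obtains C where "finite C" and "card C \<le> card (Pi\<^sub>E UNIV (symbol_words Qx k))"
    and "\<And>x l. quantized_pd U A b \<mu> Qx Ql x l \<Longrightarrow> l k - l 0 \<in> C"
proof
  define g where "g w = (\<Sum>t<k. \<chi> j. \<mu> t * (row j A \<bullet> (\<chi> i. decoder Qx i t (take (Suc t) (w i))) - b $ j))"
    for w
  let ?W = "Pi\<^sub>E UNIV (symbol_words Qx k)"
  have fin: "finite ?W" by (intro finite_PiE) (auto simp: card_symbol_words[OF assms])
  show "finite (g ` ?W)" using fin by simp
  show "card (g ` ?W) \<le> card ?W" using fin by (rule card_image_le)
  fix x l assume pd: "quantized_pd U A b \<mu> Qx Ql x l"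
  define w where "w i = symbols Qx i (\<lambda>n. x n $ i) k" for i
  have "l k - l 0 = (\<Sum>t<k. l (Suc t) - l t)" by (simp add: sum_lessThan_telescope)
  also have "\<dots> = g w"
    unfolding g_def
  proof (intro sum.cong refl)
    fix t assume "t \<in> {..<k}"
    then have "(\<chi> i. decoder Qx i t (take (Suc t) (w i))) = quantized Qx x t"
      unfolding w_def quantized_def by (subst take_symbols) auto
    then show "l (Suc t) - l t = (\<chi> j. \<mu> t * (row j A \<bullet> (\<chi> i. decoder Qx i t (take (Suc t) (w i))) - b $ j))"
      using pd by (simp add: vec_eq_iff quantized_pd_def)
  qed
  finally show "l k - l 0 \<in> g ` ?W"
    using symbols_in_symbol_words[OF assms] by (auto simp: w_def)
qed

section \<open>The asymptotic bound\<close>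

lemma ln_ennreal_ge:
  assumes "e > 0" and "ennreal e \<le> y"
  shows "ereal (ln e) \<le> ln_ennreal y"
proof (cases "y = \<infinity>")
  case False
  then have "enn2real (ennreal e) \<le> enn2real y"
    using assms(2) by (intro enn2real_mono) (auto simp: less_top)
  then have "e \<le> enn2real y" using assms(1) by simp
  moreover have "y \<noteq> 0" using assms by auto
  ultimately show ?thesis using False assms by (simp add: ln_ennreal_def)
qed (simp add: ln_ennreal_def)

theorem theorem3:
  fixes U :: "'m::finite \<Rightarrow> real \<Rightarrow> real"
    and A :: "real ^ 'm ^ 'n::finite"
    and b :: "real ^ 'n"
    and Umin Umax :: "'m \<Rightarrow> real"
    and \<mu> :: "nat \<Rightarrow> real"
    and \<mu>_lim :: real
    and xopt :: "real ^ 'm"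
    and lopt :: "real ^ 'n"
    and Qx :: "('m, 's) quantizer"
    and Ql :: "('n, 't) quantizer"
    and P :: "'w measure"
    and X :: "nat \<Rightarrow> 'w \<Rightarrow> real ^ 'm"
    and L :: "nat \<Rightarrow> 'w \<Rightarrow> real ^ 'n"
    and px :: "real ^ 'm \<Rightarrow> real"
    and pl :: "real ^ 'n \<Rightarrow> real"
    and Rx :: ereal
  assumes dims: "CARD('n) < CARD('m)"
    and primal: "primal_optimal U A b xopt"
    and dual: "dual_optimal U A b lopt"
    and concave: "\<And>i. concave_on UNIV (U i)"
    and diff1: "\<And>i y. U i field_differentiable at y"
    and diff2: "\<And>i y. deriv (U i) field_differentiable at y"
    and cont2: "\<And>i. continuous_on UNIV (deriv (deriv (U i)))"
    and curv_lower: "\<And>i y. Umin i \<le> deriv (deriv (U i)) y"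
    and curv_upper: "\<And>i y. deriv (deriv (U i)) y \<le> Umax i"
    and Umax_neg: "\<And>i. Umax i < 0"
    and step_bound: "\<And>k. \<mu> k \<le> (MIN i. 1 / \<bar>Umin i\<bar>)"
    and step_lim: "\<mu> \<longlonglongrightarrow> \<mu>_lim" "\<mu>_lim > 0"
    and prob: "prob_space P"
    and entropy_x: "information_space.finite_entropy P (exp 1) lborel (X 0) px"
    and entropy_l: "information_space.finite_entropy P (exp 1) lborel (L 0) pl"
    and indep: "prob_space.indep_set P
        (sets (vimage_algebra (space P) (X 0) borel))
        (sets (vimage_algebra (space P) (L 0) borel))"
    and scheme: "valid_quantizer Qx" "valid_quantizer Ql"
    and pd: "\<And>\<omega>. \<omega> \<in> space P \<Longrightarrow> quantized_pd U A b \<mu> Qx Ql (\<lambda>k. X k \<omega>) (\<lambda>k. L k \<omega>)"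
    and OA: "optimum_achieving U A b \<mu> px pl xopt lopt Qx Ql"
    and rate: "(\<lambda>k. ereal (average_rate Qx k)) \<longlonglongrightarrow> Rx"
  shows "liminf (\<lambda>k. ereal (1 / real k) *
             ln_ennreal (\<integral>\<^sup>+ \<omega>. ennreal ((norm (L k \<omega> - lopt))\<^sup>2) \<partial>P))
         \<ge> - ereal (2 / real CARD('n)) * Rx"
proof -
  interpret prob_space P by (rule prob)
  interpret information_space P "exp 1" by unfold_locales simp
  let ?N = "real CARD('n)"
  let ?E = "\<lambda>k. \<integral>\<^sup>+ \<omega>. ennreal ((norm (L k \<omega> - lopt))\<^sup>2) \<partial>P"
  have dist: "distributed P lborel (L 0) (\<lambda>z. ennreal (pl z))"
    using entropy_l by (simp add: finite_entropy_def)
  have "pl \<in> borel_measurable borel"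
    using finite_entropy_measurable[OF entropy_l] by simp
  then obtain c where c: "c > 0" and bound: "\<And>C F s. finite C \<Longrightarrow> real (card C) \<le> s \<Longrightarrow> s > 0
      \<Longrightarrow> (\<And>\<omega>. \<omega> \<in> space P \<Longrightarrow> F \<omega> - L 0 \<omega> \<in> C)
      \<Longrightarrow> ennreal (c * s powr (- 2 / ?N)) \<le> (\<integral>\<^sup>+ \<omega>. ennreal ((norm (F \<omega>))\<^sup>2) \<partial>P)"
    using quantization_error_lower_bound[OF prob dist] by auto
  let ?low = "\<lambda>k. ereal (ln c * (1 / real k)) + - ereal (2 / ?N) * ereal (average_rate Qx k)"
  have low: "?low k \<le> ereal (1 / real k) * ln_ennreal (?E k)" if k: "k > 0" for k
  proof -
    let ?s = "exp (real k * average_rate Qx k)"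
    obtain C where C: "finite C" "card C \<le> card (Pi\<^sub>E UNIV (symbol_words Qx k))"
      and inc: "\<And>x l. quantized_pd U A b \<mu> Qx Ql x l \<Longrightarrow> l k - l 0 \<in> C"
      using dual_increment_range[OF scheme(1)] by metis
    let ?C = "(\<lambda>d. d - lopt) ` C"
    have "card ?C \<le> card C" using C(1) by (rule card_image_le)
    then have "real (card ?C) \<le> ?s"
      using C(2) card_joint_symbol_words[OF scheme(1) k] by linarith
    moreover have "(L k \<omega> - lopt) - L 0 \<omega> \<in> ?C" if "\<omega> \<in> space P" for \<omega>
      using inc[OF pd[OF that]] by (intro image_eqI[of _ _ "L k \<omega> - L 0 \<omega>"]) auto
    ultimately have "ennreal (c * ?s powr (- 2 / ?N)) \<le> ?E k"
      using C(1) by (intro bound[of ?C]) auto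
    then have "ereal (ln (c * ?s powr (- 2 / ?N))) \<le> ln_ennreal (?E k)"
      using c by (intro ln_ennreal_ge) auto
    then have "ereal (1 / real k) * ereal (ln (c * ?s powr (- 2 / ?N)))
        \<le> ereal (1 / real k) * ln_ennreal (?E k)"
      by (rule ereal_mult_left_mono) simp
    moreover have "?low k = ereal (1 / real k) * ereal (ln (c * ?s powr (- 2 / ?N)))"
      using k c by (simp add: ln_mult ln_powr field_simps)
    ultimately show ?thesis by (simp only:)
  qed
  have "(\<lambda>k. ln c * (1 / real k)) \<longlonglongrightarrow> 0"
    using tendsto_mult_right_zero[OF lim_1_over_n] by blast
  then have "(\<lambda>k. ereal (ln c * (1 / real k))) \<longlonglongrightarrow> 0" by (simp add: zero_ereal_def)
  moreover have "(\<lambda>k. - ereal (2 / ?N) * ereal (average_rate Qx k)) \<longlonglongrightarrow> - ereal (2 / ?N) * Rx"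
    using rate by (intro tendsto_cmult_ereal) auto
  ultimately have "?low \<longlonglongrightarrow> 0 + - ereal (2 / ?N) * Rx"
    by (intro tendsto_add_ereal_general2) auto
  then have "- ereal (2 / ?N) * Rx = liminf ?low"
    by (simp add: lim_imp_Liminf)
  also have "\<dots> \<le> liminf (\<lambda>k. ereal (1 / real k) * ln_ennreal (?E k))"
    using low by (intro Liminf_mono eventually_sequentiallyI[of 1]) auto
  finally show ?thesis .
qed

end
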